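(* Let $\sigma_i=k_i(q)\in\mathbb{R}^{m_i}$ and $\sigma_j=k_j(q)\in\mathbb{R}^{m_j}$ be two Jacobian-based tasks on the configuration space $\mathcal{Q}$, with task Jacobians $J_i(q)\neq 0$ and $J_j(q)\neq 0$ (so $\dot\sigma_i=J_i(q)\dot q$, $\dot\sigma_j=J_j(q)\dot q$), and let $h_i(\sigma_i(q))$, $h_j(\sigma_j(q))$ encode the corresponding extended set-based (ESB) tasks, with $\frac{\partial h_i}{\partial q}\neq0$ and $\frac{\partial h_j}{\partial q}\neq 0$. If the two Jacobian-based tasks are independent, i.e. $$\mathrm{rank}(J_i(q)^{\sf T})+\mathrm{rank}(J_j(q)^{\sf T})=\mathrm{rank}\big(\begin{bmatrix}J_i(q)^{\sf T} & J_j(q)^{\sf T}\end{bmatrix}\big)\quad\forall q\in\mathcal{Q},$$ then the corresponding ESB tasks are independent, i.e. $$\mathrm{rank}\left(\begin{bmatrix}\frac{\partial h_i}{\partial q}^{\sf T} & \frac{\partial h_j}{\partial q}^{\sf T}\end{bmatrix}\right)=2\quad\forall q\in\mathcal{Q}.$$ The converse is not necessarily true: there exist Jacobian-based tasks and corresponding ESB tasks such that the ESB tasks are independent but the Jacobian-based tasks are not.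
   Context: $\mathcal{Q}$ is the $N$-dimensional joint configuration space of a robot. A Jacobian-based task is given by a smooth map $k:\mathcal{Q}\to\mathbb{R}^{m}$, $\sigma=k(q)$, with Jacobian $J(q)=\frac{\partial k}{\partial q}(q)\in\mathbb{R}^{m\times N}$. An ESB task is a task characterized by a set $\mathcal{C}=\{\sigma\in\mathcal{T}: h(\sigma)\ge 0\}$ of the task space $\mathcal{T}$ (here $\mathbb{R}^m$), where $h:\mathcal{T}\to\mathbb{R}$ is continuously differentiable; the goal is to render $\mathcal{C}$ forward invariant and asymptotically stable. An ESB task corresponding to a Jacobian-based task $\sigma=k(q)$ is encoded by such an $h$ evaluated at $\sigma=k(q)$; its gradient with respect to $q$ is the row vector $\frac{\partial h}{\partial q}=\frac{\partial h}{\partial\sigma}J(q)$. *)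

theory Defs
  imports "HOL-Analysis.Analysis"
begin

primrec higher_differentiable_on ::
    "'a::real_normed_vector set \<Rightarrow> ('a \<Rightarrow> 'b::real_normed_vector) \<Rightarrow> nat \<Rightarrow> bool" where
  "higher_differentiable_on S f 0 \<longleftrightarrow> continuous_on S f"
| "higher_differentiable_on S f (Suc n) \<longleftrightarrow>
     (\<forall>x\<in>S. f differentiable (at x)) \<and>
     (\<forall>v. higher_differentiable_on S (\<lambda>x. frechet_derivative f (at x) v) n)"

(* Both notions are meant for open S in finite dimension: all directional derivatives
   up to the given order exist and are continuous, i.e. C^infinity and C^1. *)
definition smooth_on :: "'a::euclidean_space set \<Rightarrow> ('a \<Rightarrow> 'b::real_normed_vector) \<Rightarrow> bool" where
  "smooth_on S f \<longleftrightarrow> (\<forall>n. higher_differentiable_on S f n)"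

definition continuously_differentiable_on ::
    "'a::euclidean_space set \<Rightarrow> ('a \<Rightarrow> 'b::real_normed_vector) \<Rightarrow> bool" where
  "continuously_differentiable_on S f \<longleftrightarrow> higher_differentiable_on S f 1"

(* The configuration space is an open subset of R^N (joint coordinates). *)
definition configuration_space :: "(real^'n) set \<Rightarrow> bool" where
  "configuration_space Q \<longleftrightarrow> open Q \<and> Q \<noteq> {}"

definition jacobian_based_task :: "(real^'n) set \<Rightarrow> (real^'n \<Rightarrow> real^'m) \<Rightarrow> bool" where
  "jacobian_based_task Q k \<longleftrightarrow> smooth_on Q k"

definition task_jacobian :: "(real^'n \<Rightarrow> real^'m) \<Rightarrow> real^'n \<Rightarrow> real^'n^'m" where
  "task_jacobian k q = jacobian k (at q)"

(* The task space is all of R^m.  Forward invariance and asymptotic stability of C are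
   control objectives attached to the task, not conditions on C or h. *)
definition esb_task :: "(real^'m) set \<Rightarrow> (real^'m \<Rightarrow> real) \<Rightarrow> bool" where
  "esb_task C h \<longleftrightarrow> continuously_differentiable_on UNIV h \<and> C = {\<sigma>. h \<sigma> \<ge> 0}"

(* The row vector dh/dq: the 1 x N Jacobian of q \<mapsto> h (k q), where vec :: real \<Rightarrow> real^1
   identifies the reals with R^1. *)
definition esb_gradient ::
    "(real^'m \<Rightarrow> real) \<Rightarrow> (real^'n \<Rightarrow> real^'m) \<Rightarrow> real^'n \<Rightarrow> real^'n^1" where
  "esb_gradient h k q = jacobian (\<lambda>p. vec (h (k p)) :: real^1) (at q)"

(* The block matrix [A B]; its columns are indexed by the disjoint sum of the index types. *)
definition hblock :: "'a^'m^'n \<Rightarrow> 'a^'l^'n \<Rightarrow> 'a^('m + 'l)^'n" where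
  "hblock A B = (\<chi> r c. case c of Inl a \<Rightarrow> A $ r $ a | Inr b \<Rightarrow> B $ r $ b)"

definition jacobian_tasks_independent ::
    "(real^'n) set \<Rightarrow> (real^'n \<Rightarrow> real^'mi) \<Rightarrow> (real^'n \<Rightarrow> real^'mj) \<Rightarrow> bool" where
  "jacobian_tasks_independent Q ki kj \<longleftrightarrow>
     (\<forall>q\<in>Q. rank (transpose (task_jacobian ki q)) + rank (transpose (task_jacobian kj q)) =
        rank (hblock (transpose (task_jacobian ki q)) (transpose (task_jacobian kj q))))"

definition esb_tasks_independent ::
    "(real^'n) set \<Rightarrow> (real^'mi \<Rightarrow> real) \<Rightarrow> (real^'n \<Rightarrow> real^'mi) \<Rightarrow>
       (real^'mj \<Rightarrow> real) \<Rightarrow> (real^'n \<Rightarrow> real^'mj) \<Rightarrow> bool" where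
  "esb_tasks_independent Q hi ki hj kj \<longleftrightarrow>
     (\<forall>q\<in>Q. rank (hblock (transpose (esb_gradient hi ki q)) (transpose (esb_gradient hj kj q))) = 2)"

end

theory Submission
  imports Defs
begin

text \<open>By the chain rule, the gradient of an ESB task lies in the row space of the task Jacobian.
  Additivity of the ranks says that the two row spaces meet only in 0, so two nonzero vectors, one
  in each, are linearly independent. For the failure of the converse, two coordinate functions of
  the same (identity) task have independent gradients.\<close>

lemma higher_differentiable_on_const: "higher_differentiable_on S (\<lambda>x. c) n"
  by (induction n arbitrary: c) simp_all

text \<open>A bounded linear map is its own derivative at every point, so each directional
  derivative is a constant function, and constants are differentiable to every order.\<close>

lemma smooth_on_bounded_linear:
  assumes "bounded_linear f"
  shows "smooth_on S f"
proof -
  have "frechet_derivative f (at x) = f" for x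
    using assms bounded_linear_imp_has_derivative frechet_derivative_at by metis
  then have "higher_differentiable_on S f n" for n
    using assms
    by (cases n)
      (simp_all add: higher_differentiable_on_const linear_continuous_on
        bounded_linear_imp_differentiable)
  then show ?thesis
    by (simp add: smooth_on_def)
qed

lemma columns_eq_range: "columns M = range (\<lambda>i. column i M)"
  by (auto simp: columns_def)

text \<open>With rank read as column rank, every rank of a block matrix below becomes the dimension
  of a union of column sets.\<close>

lemma columns_hblock: "columns (hblock A B) = columns A \<union> columns B"
proof -
  have "column (Inl a) (hblock A B) = column a A" "column (Inr b) (hblock A B) = column b B" for a b
    by (simp_all add: column_def hblock_def)
  then show ?thesis
    by (simp add: columns_eq_range UNIV_sum image_Un image_image)
qed

text \<open>The column space of the block matrix is the sum U + V of the two column spaces, and dim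
  (U + V) + dim (U \<inter> V) = dim U + dim V. Additivity of the ranks therefore forces dim (U
  \<inter> V) = 0.\<close>

lemma span_columns_Int_trivial:
  fixes A :: "real^'m^'n" and B :: "real^'l^'n"
  assumes "rank A + rank B = rank (hblock A B)"
  shows "span (columns A) \<inter> span (columns B) = {0}"
proof -
  have "dim {x + y |x y. x \<in> span (columns A) \<and> y \<in> span (columns B)} = dim (columns A \<union> columns B)"
    by (simp flip: span_Un)
  with dim_sums_Int[of "span (columns A)" "span (columns B)"] assms
  have "dim (span (columns A) \<inter> span (columns B)) = 0"
    by (simp add: column_rank_def columns_hblock)
  then show ?thesis
    by (auto simp: span_zero)
qed

lemma rank_hblock_eq_2:
  fixes A :: "real^'m^'n" and B :: "real^'l^'n"
  assumes "span (columns A) \<inter> span (columns B) = {0}"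
    and "u \<in> span (columns A)" "v \<in> span (columns B)" "u \<noteq> 0" "v \<noteq> 0"
    and "columns U = {u}" "columns V = {v}"
  shows "rank (hblock U V) = 2"
proof -
  have "span {v} \<subseteq> span (columns B)"
    using assms(3) by (simp add: span_minimal)
  \<comment> \<open>Otherwise \<open>u\<close> would lie in both column spaces and hence be
    0.\<close>
  then have "u \<notin> span {v}"
    using assms by blast
  then have "independent {u, v}" "u \<noteq> v"
    using assms by (auto simp: independent_insert span_base)
  then show ?thesis
    by (simp add: column_rank_def columns_hblock assms dim_eq_card_independent insert_commute)
qed

lemma rows_row_matrix: "rows (G :: 'a^'n^1) = {G $ 1}"
  by (auto simp: rows_def row_def)

lemma bounded_linear_vec_real: "bounded_linear (vec :: real \<Rightarrow> real^'n)"
  by (simp flip: linear_conv_bounded_linear)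

text \<open>The chain rule factors the gradient as a row vector times the task Jacobian, and such a
  product is a linear combination of the rows of the Jacobian.\<close>

lemma esb_gradient_in_row_space:
  fixes k :: "real^'n \<Rightarrow> real^'m"
  assumes "k differentiable (at q)" "h differentiable (at (k q))"
  shows "esb_gradient h k q $ 1 \<in> span (rows (task_jacobian k q))"
proof -
  obtain k' h' where k: "(k has_derivative k') (at q)" and h: "(h has_derivative h') (at (k q))"
    using assms by (auto simp: differentiable_def)
  \<comment> \<open>The derivative of \<open>h\<close>, with its scalar value moved into
    \<open>real^1\<close>, so that the composite with \<open>k'\<close> is a product of
    matrices.\<close>
  define g where "g = (\<lambda>y. vec (h' y) :: real^1)"
  have "(h \<circ> k has_derivative h' \<circ> k') (at q)"
    using diff_chain_at[OF k h] .
  from bounded_linear.has_derivative[OF bounded_linear_vec_real this]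
  have "((\<lambda>p. vec (h (k p)) :: real^1) has_derivative g \<circ> k') (at q)"
    by (simp add: g_def o_def)
  then have "esb_gradient h k q = matrix (g \<circ> k')"
    by (simp add: esb_gradient_def jacobian_def flip: frechet_derivative_at)
  also have "\<dots> = matrix g ** matrix k'"
  proof (rule matrix_compose)
    show "linear k'"
      using k by (rule has_derivative_linear)
    show "linear g"
      unfolding g_def using linear_compose[OF has_derivative_linear[OF h] linear_vec]
      by (simp add: o_def)
  qed
  also have "matrix k' = task_jacobian k q"
    using k by (simp add: task_jacobian_def jacobian_def flip: frechet_derivative_at)
  \<comment> \<open>Transposing the product exhibits the gradient as a member of the column space of
    the transposed Jacobian, with the partial derivatives of \<open>h\<close> as
    coefficients.\<close>
  finally have "esb_gradient h k q $ 1 = transpose (task_jacobian k q) *v (matrix g $ 1)"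
    by (simp add: vec_eq_iff matrix_matrix_mult_def matrix_vector_mult_def transpose_def mult.commute)
  then show ?thesis
    using matrix_vector_mult_in_columnspace[of "transpose (task_jacobian k q)"]
    by (simp only: columns_transpose)
qed

lemma esb_tasks_independent_if_jacobian_tasks_independent:
  assumes "jacobian_based_task Q ki" "jacobian_based_task Q kj"
    and "esb_task Ci hi" "esb_task Cj hj"
    and "\<forall>q\<in>Q. esb_gradient hi ki q \<noteq> 0" "\<forall>q\<in>Q. esb_gradient hj kj q \<noteq> 0"
    and "jacobian_tasks_independent Q ki kj"
  shows "esb_tasks_independent Q hi ki hj kj"
  unfolding esb_tasks_independent_def
proof
  fix q
  assume q: "q \<in> Q"
  have "higher_differentiable_on Q ki (Suc 0)" "higher_differentiable_on Q kj (Suc 0)"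
    using assms(1,2) by (auto simp only: jacobian_based_task_def smooth_on_def)
  then have k: "ki differentiable (at q)" "kj differentiable (at q)"
    using q by auto
  have h: "hi differentiable (at (ki q))" "hj differentiable (at (kj q))"
    using assms(3,4) by (auto simp: esb_task_def continuously_differentiable_on_def)
  have "esb_gradient hi ki q $ 1 \<noteq> 0" "esb_gradient hj kj q $ 1 \<noteq> 0"
    using assms(5,6) q by (auto simp: vec_eq_iff forall_1)
  \<comment> \<open>Here \<open>A\<close> and \<open>B\<close> of \<open>rank_hblock_eq_2\<close>
    are the transposed task Jacobians, and \<open>u\<close> and \<open>v\<close> are the single rows
    of the two gradients, which become single columns after transposition.\<close>
  with assms(7) q esb_gradient_in_row_space[OF k(1) h(1)] esb_gradient_in_row_space[OF k(2) h(2)]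
  show "rank (hblock (transpose (esb_gradient hi ki q)) (transpose (esb_gradient hj kj q))) = 2"
    by (intro rank_hblock_eq_2[OF span_columns_Int_trivial])
      (auto simp: jacobian_tasks_independent_def rows_row_matrix)
qed

text \<open>A coordinate function is linear, so its gradient is the same unit vector everywhere,
  here written as a matrix with one row.\<close>

lemma esb_gradient_component:
  "esb_gradient (\<lambda>x. x $ a) (\<lambda>x. x) q = ((\<chi> i. axis a 1) :: real^'n^1)"
proof -
  have "((\<lambda>p. vec (p $ a) :: real^1) has_derivative (\<lambda>p. vec (p $ a))) (at q)"
    by (intro bounded_linear_imp_has_derivative bounded_linear_vec_real
        bounded_linear_compose[OF bounded_linear_vec_real bounded_linear_vec_nth])
  then show ?thesis
    by (simp add: esb_gradient_def jacobian_def matrix_def axis_def vec_eq_iff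
        flip: frechet_derivative_at)
qed

lemma task_jacobian_ident: "task_jacobian (\<lambda>x. x) q = mat 1"
  by (simp add: task_jacobian_def jacobian_def matrix_id_mat_1 flip: id_def)

lemma esb_task_component: "esb_task {x :: real^'n. x $ a \<ge> 0} (\<lambda>x. x $ a)"
proof -
  have "smooth_on UNIV (\<lambda>x :: real^'n. x $ a)"
    by (intro smooth_on_bounded_linear bounded_linear_vec_nth)
  then show ?thesis
    unfolding esb_task_def continuously_differentiable_on_def smooth_on_def by blast
qed

lemma converse_counterexample:
  defines "k \<equiv> (\<lambda>x :: real^2. x)"
  shows "esb_tasks_independent UNIV (\<lambda>x. x $ 1) k (\<lambda>x. x $ 2) k"
    and "\<not> jacobian_tasks_independent UNIV k k"
proof -
  \<comment> \<open>These are the two gradients, and they belong to the standard basis.\<close>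
  have "independent {axis 1 1, axis 2 1 :: real^2}"
    by (rule independent_mono[OF independent_Basis]) (auto simp: axis_in_Basis_iff)
  then have "dim {axis 1 1, axis 2 1 :: real^2} = 2"
    by (simp add: dim_eq_card_independent axis_eq_axis)
  then show "esb_tasks_independent UNIV (\<lambda>x. x $ 1) k (\<lambda>x. x $ 2) k"
    by (simp add: k_def esb_tasks_independent_def column_rank_def columns_hblock
        rows_row_matrix esb_gradient_component insert_commute)
  \<comment> \<open>Repeating a block adds no new columns. For the identity Jacobian, additivity
    would thus read 2 + 2 = 2.\<close>
  have "rank (hblock A A) = rank A" for A :: "real^2^2"
    by (simp add: column_rank_def columns_hblock)
  then show "\<not> jacobian_tasks_independent UNIV k k"
    by (simp add: k_def jacobian_tasks_independent_def task_jacobian_ident rank_I)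
qed

theorem proposition2:
  shows "(\<forall>(Q :: (real^'n) set)
            (ki :: real^'n \<Rightarrow> real^'mi) (kj :: real^'n \<Rightarrow> real^'mj)
            (Ci :: (real^'mi) set) (Cj :: (real^'mj) set)
            (hi :: real^'mi \<Rightarrow> real) (hj :: real^'mj \<Rightarrow> real).
            configuration_space Q \<longrightarrow>
            jacobian_based_task Q ki \<longrightarrow> jacobian_based_task Q kj \<longrightarrow>
            (\<forall>q\<in>Q. task_jacobian ki q \<noteq> 0) \<longrightarrow> (\<forall>q\<in>Q. task_jacobian kj q \<noteq> 0) \<longrightarrow>
            esb_task Ci hi \<longrightarrow> esb_task Cj hj \<longrightarrow>
            (\<forall>q\<in>Q. esb_gradient hi ki q \<noteq> 0) \<longrightarrow> (\<forall>q\<in>Q. esb_gradient hj kj q \<noteq> 0) \<longrightarrow>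
            jacobian_tasks_independent Q ki kj \<longrightarrow>
            esb_tasks_independent Q hi ki hj kj)
       \<and> (\<exists>(Q :: (real^2) set)
            (ki :: real^2 \<Rightarrow> real^2) (kj :: real^2 \<Rightarrow> real^2)
            (Ci :: (real^2) set) (Cj :: (real^2) set)
            (hi :: real^2 \<Rightarrow> real) (hj :: real^2 \<Rightarrow> real).
            configuration_space Q \<and>
            jacobian_based_task Q ki \<and> jacobian_based_task Q kj \<and>
            (\<forall>q\<in>Q. task_jacobian ki q \<noteq> 0) \<and> (\<forall>q\<in>Q. task_jacobian kj q \<noteq> 0) \<and>
            esb_task Ci hi \<and> esb_task Cj hj \<and>
            (\<forall>q\<in>Q. esb_gradient hi ki q \<noteq> 0) \<and> (\<forall>q\<in>Q. esb_gradient hj kj q \<noteq> 0) \<and>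
            esb_tasks_independent Q hi ki hj kj \<and>
            \<not> jacobian_tasks_independent Q ki kj)"
proof (intro conjI allI impI exI)
  fix Q :: "(real^'n) set" and ki :: "real^'n \<Rightarrow> real^'mi" and kj :: "real^'n \<Rightarrow> real^'mj"
    and Ci Cj hi hj
  assume "jacobian_based_task Q ki" "jacobian_based_task Q kj"
    and "esb_task Ci hi" "esb_task Cj hj"
    and "\<forall>q\<in>Q. esb_gradient hi ki q \<noteq> 0" "\<forall>q\<in>Q. esb_gradient hj kj q \<noteq> 0"
    and "jacobian_tasks_independent Q ki kj"
  then show "esb_tasks_independent Q hi ki hj kj"
    by (rule esb_tasks_independent_if_jacobian_tasks_independent)
next
  let ?Q = "UNIV :: (real^2) set" and ?k = "\<lambda>x :: real^2. x"
  show "configuration_space ?Q"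
    by (simp add: configuration_space_def)
  \<comment> \<open>The statement appears twice because the identity map serves as both
    \<open>ki\<close> and \<open>kj\<close>.\<close>
  show "jacobian_based_task ?Q ?k" "jacobian_based_task ?Q ?k"
    by (simp_all add: jacobian_based_task_def smooth_on_bounded_linear bounded_linear_ident)
  show "\<forall>q\<in>?Q. task_jacobian ?k q \<noteq> 0" "\<forall>q\<in>?Q. task_jacobian ?k q \<noteq> 0"
    by (simp_all add: task_jacobian_ident mat_def vec_eq_iff)
  \<comment> \<open>The two tasks are told apart only here: \<open>hi\<close> and \<open>hj\<close>
    are the two coordinates, with closed half-planes as their sets.\<close>
  show "esb_task {x :: real^2. x $ 1 \<ge> 0} (\<lambda>x. x $ 1)"
    "esb_task {x :: real^2. x $ 2 \<ge> 0} (\<lambda>x. x $ 2)"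
    by (rule esb_task_component)+
  show "\<forall>q\<in>?Q. esb_gradient (\<lambda>x. x $ 1) ?k q \<noteq> 0" "\<forall>q\<in>?Q. esb_gradient (\<lambda>x. x $ 2) ?k q \<noteq> 0"
    by (simp_all add: esb_gradient_component vec_eq_iff axis_def)
  show "esb_tasks_independent ?Q (\<lambda>x. x $ 1) ?k (\<lambda>x. x $ 2) ?k"
    by (rule converse_counterexample)
  show "\<not> jacobian_tasks_independent ?Q ?k ?k"
    by (rule converse_counterexample)
qed

end
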